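(* Let $n>4$ and let $\mathscr{T}_{n,\lceil n/3\rceil}$ be the set of all trees on $n$ vertices with domination number $\lceil n/3\rceil$. Among all trees in $\mathscr{T}_{n,\lceil n/3\rceil}$, the path $P_n$ has the maximal eccentric distance sum.
   Context: All graphs are simple and connected. For a graph $G$ and vertices $u,v$, $d_G(u,v)$ is the distance between $u$ and $v$; $D_G(v)=\sum_{u\in V_G}d_G(u,v)$; the eccentricity $\varepsilon_G(v)$ is the maximum distance from $v$ to any vertex. The eccentric distance sum is $\xi^d(G)=\sum_{v\in V_G}\varepsilon_G(v)D_G(v)$. The domination number of $G$ is the minimum size of a set $S\subseteq V_G$ such that every vertex outside $S$ is adjacent to a vertex of $S$. *)

theory Defs
  imports "Graph_Theory.Graph_Theory"
begin

text \<open>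
  A finite simple graph is a \<^locale>\<open>pair_graph\<close>: a finite vertex set with an irreflexive symmetric
  arc relation, each edge being represented by its two opposite arcs. Because of this, every edge
  yields a \<^const>\<open>pre_digraph.cycle\<close> of length 2, so \<^const>\<open>forest\<close> and \<^const>\<open>tree\<close> from the library
  fail for every such graph having an edge. The cycles of the undirected graph are those of length
  at least 3.
\<close>

definition undirected_tree :: "'a pair_pre_digraph \<Rightarrow> bool" where
  "undirected_tree G \<longleftrightarrow>
     pair_graph G \<and> connected (with_proj G) \<and>
     \<not> (\<exists>p. pre_digraph.cycle (with_proj G) p \<and> 3 \<le> length p)"

text \<open>The distance is meaningful only if some walk joins the two vertices.\<close>

definition graph_dist :: "'a pair_pre_digraph \<Rightarrow> 'a \<Rightarrow> 'a \<Rightarrow> nat" where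
  "graph_dist G u v = (LEAST k. \<exists>p. pre_digraph.awalk (with_proj G) u p v \<and> length p = k)"

definition dist_sum :: "'a pair_pre_digraph \<Rightarrow> 'a \<Rightarrow> nat" where
  "dist_sum G v = (\<Sum>u\<in>pverts G. graph_dist G u v)"

definition eccentricity :: "'a pair_pre_digraph \<Rightarrow> 'a \<Rightarrow> nat" where
  "eccentricity G v = Max ((\<lambda>u. graph_dist G v u) ` pverts G)"

definition eccentric_dist_sum :: "'a pair_pre_digraph \<Rightarrow> nat" where
  "eccentric_dist_sum G = (\<Sum>v\<in>pverts G. eccentricity G v * dist_sum G v)"

definition dominating_set :: "'a pair_pre_digraph \<Rightarrow> 'a set \<Rightarrow> bool" where
  "dominating_set G S \<longleftrightarrow>
     S \<subseteq> pverts G \<and> (\<forall>v\<in>pverts G - S. \<exists>u\<in>S. (v, u) \<in> parcs G)"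

definition domination_number :: "'a pair_pre_digraph \<Rightarrow> nat" where
  "domination_number G = Min (card ` {S. dominating_set G S})"

definition trees_with_domination_number :: "nat \<Rightarrow> nat \<Rightarrow> 'a pair_pre_digraph set" where
  "trees_with_domination_number n k =
     {T. undirected_tree T \<and> card (pverts T) = n \<and> domination_number T = k}"

definition path_graph :: "nat \<Rightarrow> nat pair_pre_digraph" where
  "path_graph n =
     \<lparr> pverts = {..<n},
       parcs = {(i, j). i < n \<and> j < n \<and> (j = Suc i \<or> i = Suc j)} \<rparr>"

end

theory Submission
  imports Defs
begin

text \<open>
  The distances of a tree form an integral metric satisfying the four-point condition, so every
  vertex has a farthest vertex among the two ends \<open>a\<close>, \<open>b\<close> of a diametral path. If the diameter
  \<open>D\<close> is \<open>n - 1\<close>, the tree is a path. Otherwise some leaf \<open>v\<close> lies off the diametral path, and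
  removing it changes no other eccentricity. Hence the eccentric distance sum drops by at most twice
  \<open>D\<close> times the sum of the distances to \<open>v\<close>, that is by at most
  \<open>D\<^sup>2 (2 n - 1 - D) \<le> (n - 2)\<^sup>2 (n + 1)\<close>, which is no more than the drop from the path on \<open>n\<close>
  vertices to the path on \<open>n - 1\<close> vertices. So the path is extremal among all trees of order \<open>n\<close>;
  the domination number only has to be computed for the path itself.
\<close>

section \<open>Graph metrics and the four-point condition\<close>

text \<open>The axioms are relative to \<open>V\<close>, so deleting a vertex only shrinks
  \<open>V\<close> and leaves \<open>d\<close> alone. \<open>geodesic_step\<close> makes
  \<open>d\<close> the shortest-path metric of the graph whose edges are the pairs at distance
  1.\<close>

locale graph_metric =
  fixes V :: "'a set" and d :: "'a \<Rightarrow> 'a \<Rightarrow> nat"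
  assumes finite_V: "finite V"
    and d_zero_iff: "\<And>x y. x \<in> V \<Longrightarrow> y \<in> V \<Longrightarrow> d x y = 0 \<longleftrightarrow> x = y"
    and d_sym: "\<And>x y. x \<in> V \<Longrightarrow> y \<in> V \<Longrightarrow> d x y = d y x"
    and d_triangle: "\<And>x y z. x \<in> V \<Longrightarrow> y \<in> V \<Longrightarrow> z \<in> V \<Longrightarrow> d x z \<le> d x y + d y z"
    and geodesic_step: "\<And>x z. x \<in> V \<Longrightarrow> z \<in> V \<Longrightarrow> x \<noteq> z \<Longrightarrow>
      \<exists>y\<in>V. d y z = 1 \<and> d x z = Suc (d x y)"
begin

lemma geodesic_point:
  assumes "u \<in> V" "w \<in> V" "i \<le> d u w"
  shows "\<exists>x\<in>V. d u x = i \<and> d x w = d u w - i"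
  using assms(2,3)
proof (induction "d u w - i" arbitrary: w)
  case 0
  then show ?case using d_zero_iff[of w w] by (intro bexI[of _ w]) auto
next
  case (Suc k)
  then have "u \<noteq> w" using assms(1) d_zero_iff[of u w] by auto
  then obtain y where y: "y \<in> V" "d y w = 1" "d u w = Suc (d u y)"
    using geodesic_step assms(1) Suc.prems(1) by blast
  moreover have "k = d u y - i" "i \<le> d u y" using Suc.hyps(2) y by auto
  ultimately obtain x where x: "x \<in> V" "d u x = i" "d x y = d u y - i"
    using Suc.hyps(1) by blast
  have "d x w \<le> d x y + d y w" "d u w \<le> d u x + d x w"
    using d_triangle x y assms(1) Suc.prems(1) by blast+
  then show ?case using x y \<open>i \<le> d u y\<close> by (intro bexI[of _ x]) auto
qed

lemma level_in_image:
  assumes "u \<in> V" "w \<in> V"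
  shows "{..d u w} \<subseteq> d u ` V"
  using geodesic_point[OF assms] by (fastforce simp: image_iff)

lemma dist_less_card:
  assumes "u \<in> V" "w \<in> V"
  shows "d u w < card V"
  using card_mono[OF _ level_in_image[OF assms]] card_image_le[OF finite_V, of "d u"] finite_V
  by fastforce

text \<open>With \<open>e = d u w\<close>, one vertex at each distance \<open>0..e\<close> from
  \<open>u\<close> contributes \<open>e (e + 1) / 2\<close>; each of the other
  \<open>card V - e - 1\<close> vertices contributes at most \<open>e\<close>.\<close>

lemma transmission_bound:
  assumes u: "u \<in> V" and w: "w \<in> V" and le: "\<And>x. x \<in> V \<Longrightarrow> d x u \<le> d u w"
  shows "2 * (\<Sum>x\<in>V. d x u) + d u w * Suc (d u w) \<le> 2 * card V * d u w"
proof -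
  let ?e = "d u w"
  obtain S where S: "S \<subseteq> V" "inj_on (d u) S" "{..?e} = d u ` S"
    using level_in_image[OF u w] by (auto simp: subset_image_inj)
  have fS: "finite S" using S(1) finite_V finite_subset by blast
  have cS: "card S = Suc ?e" using card_image[OF S(2)] S(3) by (metis card_atMost)
  have "(\<Sum>x\<in>S. d x u) = (\<Sum>x\<in>S. d u x)"
    using S(1) u by (intro sum.cong) (auto intro: d_sym)
  also have "\<dots> = (\<Sum>i\<le>?e. i)" using sum.reindex[OF S(2), of "\<lambda>i. i"] S(3) by simp
  finally have s1: "2 * (\<Sum>x\<in>S. d x u) = ?e * Suc ?e"
    using gauss_sum_nat[of ?e] by (simp add: atLeast0AtMost)
  have "(\<Sum>x\<in>V - S. d x u) \<le> card (V - S) * ?e"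
    using sum_bounded_above[of "V - S" "\<lambda>x. d x u" ?e] le by auto
  moreover have "(\<Sum>x\<in>V. d x u) = (\<Sum>x\<in>V - S. d x u) + (\<Sum>x\<in>S. d x u)"
    using sum.subset_diff[OF S(1) finite_V] .
  moreover have "card V = card (V - S) + Suc ?e"
    using card_Diff_subset[OF fS S(1)] card_mono[OF finite_V S(1)] cS by simp
  ultimately show ?thesis using s1 by (simp add: algebra_simps)
qed

text \<open>Only \<open>geodesic_step\<close> can break under deletion, and only if the predecessor
  of \<open>z\<close> on a geodesic from \<open>x\<close> is \<open>v\<close> itself, which would
  put \<open>v\<close> between them.\<close>

lemma remove_nonbetween:
  assumes "\<And>x z. x \<in> V - {v} \<Longrightarrow> z \<in> V - {v} \<Longrightarrow> d v z = 1 \<Longrightarrow> d x z \<noteq> d x v + d v z"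
  shows "graph_metric (V - {v}) d"
proof
  fix x z assume *: "x \<in> V - {v}" "z \<in> V - {v}" "x \<noteq> z"
  then obtain y where "y \<in> V" "d y z = 1" "d x z = Suc (d x y)"
    using geodesic_step by blast
  with * assms[of x z] show "\<exists>y\<in>V - {v}. d y z = 1 \<and> d x z = Suc (d x y)"
    by (intro bexI[of _ y]) auto
qed (use finite_V d_zero_iff d_sym d_triangle in auto)

end

text \<open>The metric form of acyclicity: for every root \<open>r\<close>, a vertex has at most one neighbour that is
  not further away from \<open>r\<close> than itself.\<close>

lemma four_point_of_unique_parent:
  assumes "graph_metric V d"
    and "\<And>r v x y. r \<in> V \<Longrightarrow> v \<in> V \<Longrightarrow> x \<in> V \<Longrightarrow> y \<in> V \<Longrightarrow> d x v = 1 \<Longrightarrow> d y v = 1 \<Longrightarrow>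
      d r x \<le> d r v \<Longrightarrow> d r y \<le> d r v \<Longrightarrow> x = y"
    and "a \<in> V" "b \<in> V" "u \<in> V" "w \<in> V"
  shows "d u w + d a b \<le> max (d u a + d w b) (d u b + d w a)"
  using assms
proof (induction "card V" arbitrary: V a b u w rule: less_induct)
  case less
  interpret graph_metric V d by fact
  \<comment> \<open>A vertex \<open>v\<close> farthest from \<open>a\<close> turns out to be a leaf,
    and the induction removes it.\<close>
  have "Max (d a ` V) \<in> d a ` V" using finite_V less.prems(3) by (intro Max_in) auto
  then obtain v where v: "v \<in> V" and "Max (d a ` V) = d a v" by auto
  then have far: "d a x \<le> d a v" if "x \<in> V" for x
    using Max_ge[of "d a ` V" "d a x"] finite_V that by simp
  show ?case
  proof (cases "v = a")
    case True
    then have "x = a" if "x \<in> V" for x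
      using far[OF that] d_zero_iff[of a a] d_zero_iff[OF \<open>a \<in> V\<close> that] \<open>a \<in> V\<close> by auto
    then show ?thesis using less.prems(3-6) by (metis d_zero_iff le_refl max.idem)
  next
    case False
    then obtain p where p: "p \<in> V" "d p v = 1" "d a v = Suc (d a p)"
      using geodesic_step less.prems(3) v by blast
    have pv: "p \<noteq> v" using p v d_zero_iff[of v v] by auto
    \<comment> \<open>No neighbour of \<open>v\<close> is further from \<open>a\<close> than
      \<open>v\<close>, so the hypothesis with root \<open>a\<close> identifies them all with
      \<open>p\<close>: every geodesic to \<open>v\<close> arrives through \<open>p\<close>.\<close>
    have up: "d x v = Suc (d x p)" if x: "x \<in> V" "x \<noteq> v" for x
    proof -
      obtain y where y: "y \<in> V" "d y v = 1" "d x v = Suc (d x y)"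
        using geodesic_step[OF x(1) v x(2)] by blast
      have "y = p"
        using less.prems(2)[OF less.prems(3) v y(1) p(1) y(2) p(2)] far[OF y(1)] far[OF p(1)]
        by blast
      then show ?thesis using y by simp
    qed
    have up': "d v x = Suc (d p x)" if "x \<in> V" "x \<noteq> v" for x
      using up[OF that] d_sym that v p(1) by simp
    have "graph_metric (V - {v}) d"
    proof (rule remove_nonbetween)
      fix x z assume *: "x \<in> V - {v}" "z \<in> V - {v}"
      then show "d x z \<noteq> d x v + d v z"
        using up[of x] up'[of z] d_triangle[of x p z] p(1) by auto
    qed
    then have IH: "d u w + d a b \<le> max (d u a + d w b) (d u b + d w a)"
      if "a \<in> V" "b \<in> V" "u \<in> V" "w \<in> V" "a \<noteq> v" "b \<noteq> v" "u \<noteq> v" "w \<noteq> v" for a b u w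
      using less.hyps[of "V - {v}" a b u w] less.prems(2) that v finite_V
        psubset_card_mono[OF finite_V, of "V - {v}"] by auto
    note z = d_zero_iff[OF v v]
    have main: "d u w + d a b \<le> max (d u a + d w b) (d u b + d w a)"
      if "a \<in> V" "b \<in> V" "u \<in> V" "w \<in> V" for a b u w
    proof -
      have t1: "d u w \<le> d u v + d v w" "d a b \<le> d a v + d v b"
        using d_triangle that v by auto
      note s = d_sym[OF v that(1)] d_sym[OF v that(2)] d_sym[OF v that(3)] d_sym[OF v that(4)]
        d_sym[OF that(1,2)] d_sym[OF that(3,4)]
      \<comment> \<open>If \<open>v\<close> occurs at least twice, symmetry and the triangle
        inequality suffice. If it occurs once, replacing it by \<open>p\<close> lowers each of the
        three sums by one. Otherwise the induction hypothesis applies directly.\<close>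
      consider "u = v" "w = v" | "a = v" "b = v" | "u = v" "a = v" | "u = v" "b = v"
        | "w = v" "a = v" | "w = v" "b = v"
        | "u = v" "w \<noteq> v" "a \<noteq> v" "b \<noteq> v" | "u \<noteq> v" "w = v" "a \<noteq> v" "b \<noteq> v"
        | "u \<noteq> v" "w \<noteq> v" "a = v" "b \<noteq> v" | "u \<noteq> v" "w \<noteq> v" "a \<noteq> v" "b = v"
        | "u \<noteq> v" "w \<noteq> v" "a \<noteq> v" "b \<noteq> v" by blast
      then show ?thesis
      proof cases
        case 7
        then show ?thesis using IH[of a b p w] that p(1) pv up'[of w] up'[of a] up'[of b] by auto
      next
        case 8
        then show ?thesis using IH[of a b u p] that p(1) pv up[of u] up'[of a] up'[of b] by auto
      next
        case 9
        then show ?thesis using IH[of p b u w] that p(1) pv up[of u] up[of w] up'[of b] by auto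
      next
        case 10
        then show ?thesis using IH[of a p u w] that p(1) pv up[of u] up[of w] up[of a] by auto
      next
        case 11
        then show ?thesis using IH that by blast
      qed (use t1 s z in auto)
    qed
    then show ?thesis using less.prems by blast
  qed
qed

section \<open>The eccentric distance sum of a path\<close>

text \<open>Truncated subtraction makes \<open>(i - j) + (j - i)\<close> the absolute difference, so
  this is the distance sum of vertex \<open>i\<close> in the path on \<open>0..n-1\<close>. In
  \<open>path_eds\<close>, \<open>max i (n - 1 - i)\<close> is its eccentricity.\<close>

definition path_dsum :: "nat \<Rightarrow> nat \<Rightarrow> nat" where
  "path_dsum n i = (\<Sum>j<n. (i - j) + (j - i))"

definition path_eds :: "nat \<Rightarrow> nat" where
  "path_eds n = (\<Sum>i<n. max i (n - 1 - i) * path_dsum n i)"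

text \<open>The recursions for paths add one vertex at each end, so that every old vertex changes in
  the same way: its eccentricity grows by 1 and its distance sum by \<open>n + 1\<close>.\<close>

lemma sum_lessThan_Suc_Suc:
  fixes f :: "nat \<Rightarrow> nat"
  shows "(\<Sum>i<Suc (Suc n). f i) = f 0 + (\<Sum>i<n. f (Suc i)) + f (Suc n)"
  by (subst sum.lessThan_Suc, subst sum.lessThan_Suc_shift, rule refl)

lemma path_dsum_0: "2 * path_dsum n 0 = n * (n - 1)"
  unfolding path_dsum_def using gauss_sum_nat[of "n - 1"]
  by (cases n) (auto simp: lessThan_Suc_atMost atLeast0AtMost)

lemma path_dsum_last: "path_dsum (Suc n) n = path_dsum (Suc n) 0"
  unfolding path_dsum_def
  by (subst sum.nat_diff_reindex[symmetric]) (auto intro!: sum.cong)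

lemma path_dsum_Suc:
  assumes "i < n"
  shows "path_dsum (Suc (Suc n)) (Suc i) = path_dsum n i + (n + 1)"
  unfolding path_dsum_def sum_lessThan_Suc_Suc using assms by simp

lemma path_dsum_ends:
  "2 * path_dsum (Suc (Suc n)) 0 = (n + 1) * (n + 2)"
  "2 * path_dsum (Suc (Suc n)) (Suc n) = (n + 1) * (n + 2)"
  using path_dsum_0[of "Suc (Suc n)"] path_dsum_last[of "Suc n"] by simp_all

text \<open>The sum is twice the Wiener index of the path, \<open>(n^3 - n) / 3\<close>, written
  without subtraction or division.\<close>

lemma sum_path_dsum: "3 * (\<Sum>i<n. path_dsum n i) + n = n ^ 3"
proof (induction n rule: induct_nat_012)
  case (ge2 n)
  have "(\<Sum>i<n. path_dsum (Suc (Suc n)) (Suc i)) = (\<Sum>i<n. path_dsum n i + (n + 1))"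
    by (intro sum.cong refl path_dsum_Suc) simp
  then have "(\<Sum>i<Suc (Suc n). path_dsum (Suc (Suc n)) i) =
      (n + 1) * (n + 2) + (\<Sum>i<n. path_dsum n i) + n * (n + 1)"
    unfolding sum_lessThan_Suc_Suc sum.distrib using path_dsum_ends[of n] by simp
  then show ?case using ge2(1) by (simp add: algebra_simps power3_eq_cube)
qed (simp_all add: path_dsum_def)

lemma max_shift:
  fixes i n :: nat
  assumes "i < n"
  shows "max (Suc i) (Suc (Suc n) - 1 - Suc i) = Suc (max i (n - 1 - i))"
  using assms by linarith

lemma path_ecc_sum_Suc_Suc:
  "(\<Sum>i<Suc (Suc n). max i (Suc (Suc n) - 1 - i)) = (\<Sum>i<n. max i (n - 1 - i)) + 3 * n + 2"
proof -
  have "(\<Sum>i<n. max (Suc i) (Suc (Suc n) - 1 - Suc i)) = (\<Sum>i<n. Suc (max i (n - 1 - i)))"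
    by (intro sum.cong refl max_shift) simp
  also have "\<dots> = (\<Sum>i<n. max i (n - 1 - i)) + n" by (simp only: sum_Suc card_lessThan)
  finally show ?thesis unfolding sum_lessThan_Suc_Suc by simp
qed

text \<open>The total eccentricity depends on the parity of the order, since the centre is one
  vertex or two; this is why the later closed forms split as well.\<close>

lemma path_ecc_sum:
  "(\<Sum>i<2 * m. max i (2 * m - 1 - i)) + m = 3 * m ^ 2"
  "(\<Sum>i<Suc (2 * m). max i (Suc (2 * m) - 1 - i)) = 3 * m ^ 2 + 2 * m"
proof (induction m)
  case (Suc m)
  case 1
  have "(\<Sum>i<Suc (Suc (2 * m)). max i (Suc (Suc (2 * m)) - 1 - i)) + Suc m = 3 * (Suc m) ^ 2"
    unfolding path_ecc_sum_Suc_Suc using Suc(1) by (simp add: power2_eq_square algebra_simps)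
  then show ?case by simp
  case 2
  have "(\<Sum>i<Suc (Suc (Suc (2 * m))). max i (Suc (Suc (Suc (2 * m))) - 1 - i)) =
      3 * (Suc m) ^ 2 + 2 * Suc m"
    unfolding path_ecc_sum_Suc_Suc using Suc(2) by (simp add: power2_eq_square algebra_simps)
  then show ?case by simp
qed simp_all

text \<open>For an old vertex the product becomes \<open>(e + 1) * (s + n + 1)\<close>, whose
  expansion gives the first four terms. The two new ends together contribute
  \<open>(n + 1)^2 * (n + 2)\<close>.\<close>

lemma path_eds_Suc_Suc:
  "path_eds (Suc (Suc n)) = path_eds n + (\<Sum>i<n. path_dsum n i) +
     (n + 1) * (\<Sum>i<n. max i (n - 1 - i)) + n * (n + 1) + (n + 1) ^ 2 * (n + 2)"
proof -
  have "(\<Sum>i<n. max (Suc i) (Suc (Suc n) - 1 - Suc i) * path_dsum (Suc (Suc n)) (Suc i)) =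
      (\<Sum>i<n. max i (n - 1 - i) * path_dsum n i + path_dsum n i +
        (n + 1) * max i (n - 1 - i) + (n + 1))"
  proof (rule sum.cong)
    fix i assume "i \<in> {..<n}"
    then have "i < n" by simp
    show "max (Suc i) (Suc (Suc n) - 1 - Suc i) * path_dsum (Suc (Suc n)) (Suc i) =
      max i (n - 1 - i) * path_dsum n i + path_dsum n i + (n + 1) * max i (n - 1 - i) + (n + 1)"
      unfolding max_shift[OF \<open>i < n\<close>] path_dsum_Suc[OF \<open>i < n\<close>] mult_Suc distrib_left
      by (simp add: algebra_simps)
  qed simp
  also have "\<dots> = path_eds n + (\<Sum>i<n. path_dsum n i) +
      (n + 1) * (\<Sum>i<n. max i (n - 1 - i)) + n * (n + 1)"
    unfolding path_eds_def sum.distrib sum_distrib_left by simp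
  moreover have "path_eds (Suc (Suc n)) = (n + 1) * path_dsum (Suc (Suc n)) 0 +
      (\<Sum>i<n. max (Suc i) (Suc (Suc n) - 1 - Suc i) * path_dsum (Suc (Suc n)) (Suc i)) +
      (n + 1) * path_dsum (Suc (Suc n)) (Suc n)"
    unfolding path_eds_def sum_lessThan_Suc_Suc by simp
  moreover have "(n + 1) * path_dsum (Suc (Suc n)) 0 + (n + 1) * path_dsum (Suc (Suc n)) (Suc n)
      = (n + 1) ^ 2 * (n + 2)"
  proof -
    have "path_dsum (Suc (Suc n)) 0 + path_dsum (Suc (Suc n)) (Suc n) = (n + 1) * (n + 2)"
      using path_dsum_ends[of n] by linarith
    then show ?thesis
      unfolding distrib_left[symmetric] power2_eq_square by (simp only: mult.assoc)
  qed
  ultimately show ?thesis by simp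
qed

text \<open>These quartics solve the two-step recursion; the factor 6 clears denominators and
  negative terms are moved to the left.\<close>

lemma path_eds_closed_form:
  "6 * path_eds (2 * m) + 8 * m ^ 3 + 7 * m ^ 2 = 25 * m ^ 4 + 2 * m"
  "6 * path_eds (Suc (2 * m)) = 25 * m ^ 4 + 42 * m ^ 3 + 17 * m ^ 2"
proof (induction m)
  case 0
  case 1 show ?case by (simp add: path_eds_def)
  case 2 show ?case by (simp add: path_eds_def path_dsum_def)
next
  case (Suc m)
  case 1
  \<comment> \<open>The sums in the recursion become opaque atoms, and the computation moves to
    \<open>int\<close>, where their closed forms may contain subtractions.\<close>
  define s where "s = (\<Sum>i<2*m. path_dsum (2*m) i)"
  define e where "e = (\<Sum>i<2*m. max i (2*m - 1 - i))"
  have s: "3 * int s + 2 * int m = (2 * int m) ^ 3"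
    using arg_cong[OF sum_path_dsum[of "2*m"], of int] unfolding s_def[symmetric] by simp
  have e: "int e = 3 * int m ^ 2 - int m"
    using arg_cong[OF path_ecc_sum(1)[of m], of int] unfolding e_def[symmetric] by simp
  have p: "6 * int (path_eds (2*m)) = 25 * int m ^ 4 + 2 * int m - 8 * int m ^ 3 - 7 * int m ^ 2"
    using arg_cong[OF Suc(1), of int] by simp
  have "int (path_eds (Suc (Suc (2*m)))) = int (path_eds (2*m)) + int s + (2 * int m + 1) * int e
      + 2 * int m * (2 * int m + 1) + (2 * int m + 1) ^ 2 * (2 * int m + 2)"
    using arg_cong[OF path_eds_Suc_Suc[of "2*m"], of int]
    unfolding s_def[symmetric] e_def[symmetric]
    by (simp add: power2_eq_square algebra_simps)
  \<comment> \<open>The grouping \<open>2 * (3 * int s)\<close> is deliberate: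
    \<open>3 * int s\<close> has integer coefficients as a polynomial in \<open>m\<close>,
    \<open>int s\<close> alone does not.\<close>
  then have "6 * int (path_eds (Suc (Suc (2*m)))) = 6 * int (path_eds (2*m)) + 2 * (3 * int s)
      + 6 * (2 * int m + 1) * int e
      + 12 * int m * (2 * int m + 1) + 6 * (2 * int m + 1) ^ 2 * (2 * int m + 2)"
    by simp
  also have "3 * int s = (2 * int m) ^ 3 - 2 * int m" using s by simp
  finally have "int (6 * path_eds (2 * Suc m) + 8 * Suc m ^ 3 + 7 * Suc m ^ 2) =
      int (25 * Suc m ^ 4 + 2 * Suc m)"
    unfolding p e by (simp add: power2_eq_square power3_eq_cube power4_eq_xxxx algebra_simps)
  then show ?case by (simp only: of_nat_eq_iff)
next
  case (Suc m)
  case 2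
  define s where "s = (\<Sum>i<Suc (2*m). path_dsum (Suc (2*m)) i)"
  define e where "e = (\<Sum>i<Suc (2*m). max i (Suc (2*m) - 1 - i))"
  have s: "3 * int s + (2 * int m + 1) = (2 * int m + 1) ^ 3"
    using arg_cong[OF sum_path_dsum[of "Suc (2*m)"], of int] unfolding s_def[symmetric]
    by (simp add: algebra_simps)
  have e: "int e = 3 * int m ^ 2 + 2 * int m"
    using arg_cong[OF path_ecc_sum(2)[of m], of int] unfolding e_def[symmetric] by simp
  have p: "6 * int (path_eds (Suc (2*m))) = 25 * int m ^ 4 + 42 * int m ^ 3 + 17 * int m ^ 2"
    using arg_cong[OF Suc(2), of int] by simp
  have "int (path_eds (Suc (Suc (Suc (2*m))))) = int (path_eds (Suc (2*m))) + int s
      + (2 * int m + 2) * int e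
      + (2 * int m + 1) * (2 * int m + 2) + (2 * int m + 2) ^ 2 * (2 * int m + 3)"
    using arg_cong[OF path_eds_Suc_Suc[of "Suc (2*m)"], of int]
    unfolding s_def[symmetric] e_def[symmetric]
    by (simp add: power2_eq_square algebra_simps)
  then have "6 * int (path_eds (Suc (Suc (Suc (2*m))))) = 6 * int (path_eds (Suc (2*m)))
      + 2 * (3 * int s) + 6 * (2 * int m + 2) * int e
      + 6 * (2 * int m + 1) * (2 * int m + 2) + 6 * (2 * int m + 2) ^ 2 * (2 * int m + 3)"
    by (simp add: power2_eq_square algebra_simps)
  also have "3 * int s = (2 * int m + 1) ^ 3 - (2 * int m + 1)" using s by simp
  finally have "int (6 * path_eds (Suc (2 * Suc m))) =
      int (25 * Suc m ^ 4 + 42 * Suc m ^ 3 + 17 * Suc m ^ 2)"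
    unfolding p e by (simp add: power2_eq_square power3_eq_cube power4_eq_xxxx algebra_simps)
  then show ?case by (simp only: of_nat_eq_iff)
qed

text \<open>With \<open>n = k + 2\<close>, the increment \<open>(n - 2)^2 * (n + 1)\<close> is the
  bound on what a leaf off a diametral path contributes. For either parity the closed forms reduce
  the claim to a coefficientwise comparison in \<open>m\<close>.\<close>

lemma path_eds_growth:
  "path_eds (Suc k) + k ^ 2 * (k + 3) \<le> path_eds (Suc (Suc k))"
proof (cases "even k")
  case True
  then obtain m where k: "k = 2 * m" by blast
  have "6 * path_eds (Suc k) = 25 * m ^ 4 + 42 * m ^ 3 + 17 * m ^ 2"
    using path_eds_closed_form(2)[of m] k by simp
  moreover have "6 * path_eds (Suc (Suc k)) + 8 * Suc m ^ 3 + 7 * Suc m ^ 2 =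
      25 * Suc m ^ 4 + 2 * Suc m"
    using path_eds_closed_form(1)[of "Suc m"] k by simp
  ultimately show ?thesis
    unfolding k by (simp add: power2_eq_square power3_eq_cube power4_eq_xxxx algebra_simps)
next
  case False
  then obtain m where k: "k = Suc (2 * m)" by (elim oddE) simp
  have "6 * path_eds (Suc k) + 8 * Suc m ^ 3 + 7 * Suc m ^ 2 = 25 * Suc m ^ 4 + 2 * Suc m"
    using path_eds_closed_form(1)[of "Suc m"] k by simp
  moreover have "6 * path_eds (Suc (Suc k)) =
      25 * Suc m ^ 4 + 42 * Suc m ^ 3 + 17 * Suc m ^ 2"
    using path_eds_closed_form(2)[of "Suc m"] k by simp
  ultimately show ?thesis
    unfolding k by (simp add: power2_eq_square power3_eq_cube power4_eq_xxxx algebra_simps)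
qed

section \<open>Extremality of the path among tree metrics\<close>

text \<open>A bare set and distance function are used so that these notions apply to
  \<open>V - {v}\<close> without building a smaller graph.\<close>

definition metric_ecc :: "'a set \<Rightarrow> ('a \<Rightarrow> 'a \<Rightarrow> nat) \<Rightarrow> 'a \<Rightarrow> nat" where
  "metric_ecc V d v = Max (d v ` V)"

definition metric_eds :: "'a set \<Rightarrow> ('a \<Rightarrow> 'a \<Rightarrow> nat) \<Rightarrow> nat" where
  "metric_eds V d = (\<Sum>v\<in>V. metric_ecc V d v * (\<Sum>u\<in>V. d u v))"

text \<open>This is Buneman's four-point condition: by permuting the points, the two largest of the
  three pairing sums are equal.\<close>

locale tree_metric = graph_metric +
  assumes four_point: "\<And>u w a b. u \<in> V \<Longrightarrow> w \<in> V \<Longrightarrow> a \<in> V \<Longrightarrow> b \<in> V \<Longrightarrow>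
    d u w + d a b \<le> max (d u a + d w b) (d u b + d w a)"
begin

text \<open>In the four-point condition for \<open>u\<close>, \<open>w\<close>, \<open>a\<close>,
  \<open>b\<close>, the terms \<open>d w a\<close> and \<open>d w b\<close> are at most
  \<open>d a b\<close> and cancel against it.\<close>

lemma dist_le_diametral:
  assumes "a \<in> V" "b \<in> V" and diam: "\<And>x y. x \<in> V \<Longrightarrow> y \<in> V \<Longrightarrow> d x y \<le> d a b"
    and "u \<in> V" "w \<in> V"
  shows "d u w \<le> max (d u a) (d u b)"
proof -
  have "d w a \<le> d a b" "d w b \<le> d a b" using diam assms by blast+
  then show ?thesis using four_point[of u w a b] assms(1,2,4,5) by linarith
qed

text \<open>The value is attained at \<open>a\<close> or \<open>b\<close> and so is the same for
  every \<open>W\<close> containing both; hence deleting any other vertex preserves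
  eccentricities.\<close>

lemma metric_ecc_diametral:
  assumes "a \<in> W" "b \<in> W" "W \<subseteq> V" "u \<in> V"
    and diam: "\<And>x y. x \<in> V \<Longrightarrow> y \<in> V \<Longrightarrow> d x y \<le> d a b"
  shows "metric_ecc W d u = max (d u a) (d u b)"
  unfolding metric_ecc_def
proof (rule Max_eqI)
  show "finite (d u ` W)" using finite_V assms(3) finite_subset by blast
  show "max (d u a) (d u b) \<in> d u ` W" using assms(1,2) by (simp add: max_def)
qed (use dist_le_diametral[of a b u] assms in auto)

text \<open>If every vertex lay on a geodesic from \<open>a\<close> to \<open>b\<close>, the
  four-point condition would make \<open>d a\<close> injective, with values in
  \<open>{..d a b}\<close>, leaving room for at most \<open>d a b + 1\<close> vertices.\<close>

lemma exists_off_geodesic: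
  assumes a: "a \<in> V" and b: "b \<in> V" and short: "Suc (d a b) < card V"
  shows "\<exists>w\<in>V. d a b < d a w + d w b"
proof (rule ccontr)
  assume "\<not> ?thesis"
  then have eq: "d a w + d w b = d a b" if "w \<in> V" for w
    using d_triangle[OF a that b] that by (meson le_antisym not_less)
  have "inj_on (d a) V"
  proof (rule inj_onI)
    fix x y assume xy: "x \<in> V" "y \<in> V" "d a x = d a y"
    then have "d x y = 0"
      using four_point[of x y a b] eq[of x] eq[of y] a b d_sym[of x a] d_sym[of y a] by auto
    then show "x = y" using d_zero_iff xy by blast
  qed
  moreover have "d a ` V \<subseteq> {..d a b}"
  proof (rule image_subsetI)
    fix w assume "w \<in> V"
    then show "d a w \<in> {..d a b}" using eq[of w] by simp
  qed
  ultimately have "card V \<le> Suc (d a b)"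
    using card_image[of "d a" V] card_mono[of "{..d a b}" "d a ` V"] by simp
  then show False using short by simp
qed

text \<open>A vertex with the largest value of \<open>d a v + d v b\<close> is a leaf, expressed here as lying strictly
  between no two other vertices.\<close>

lemma exists_removable:
  assumes a: "a \<in> V" and b: "b \<in> V" and short: "Suc (d a b) < card V"
  shows "\<exists>v\<in>V - {a, b}. tree_metric (V - {v}) d"
proof -
  let ?f = "\<lambda>v. d a v + d v b"
  obtain w where w: "w \<in> V" "d a b < ?f w" using exists_off_geodesic assms by blast
  have "Max (?f ` V) \<in> ?f ` V" using finite_V a by (intro Max_in) auto
  then obtain v where v: "v \<in> V" and "Max (?f ` V) = ?f v" by auto
  then have max: "?f x \<le> ?f v" if "x \<in> V" for x
    using Max_ge[of "?f ` V" "?f x"] finite_V that by auto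
  have off: "d a b < ?f v" using w max[of w] by simp
  have "v \<noteq> a" "v \<noteq> b" using off d_zero_iff[OF a a] d_zero_iff[OF b b] by auto
  moreover have "graph_metric (V - {v}) d"
  proof (rule remove_nonbetween)
    fix x z assume xz: "x \<in> V - {v}" "z \<in> V - {v}"
    show "d x z \<noteq> d x v + d v z"
    proof
      assume btw: "d x z = d x v + d v z"
      have pos: "0 < d x v" "0 < d v z"
        using d_zero_iff[of x v] d_zero_iff[of v z] xz v by auto
      note [simp] = d_sym[OF v a] d_sym[OF v b] d_sym[of x v] d_sym[of x a] d_sym[of x b]
        d_sym[of z v] d_sym[of z a] d_sym[of z b]
      \<comment> \<open>Since \<open>v\<close> separates \<open>x\<close> from \<open>z\<close>, one
        of these two lies behind \<open>v\<close> as seen from \<open>a\<close>, and likewise as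
        seen from \<open>b\<close>.\<close>
      have "d v z + d a v \<le> d a z \<or> d v x + d a v \<le> d a x"
        using four_point[of x z v a] xz v a b btw by auto
      moreover have "d v z + d v b \<le> d z b \<or> d v x + d v b \<le> d x b"
        using four_point[of x z v b] xz v a b btw by auto
      \<comment> \<open>If different vertices lie behind \<open>v\<close> for \<open>a\<close> and
        for \<open>b\<close>, these inequalities either put \<open>v\<close> on a geodesic from
        \<open>a\<close> to \<open>b\<close>, against \<open>off\<close>, or put one vertex behind
        \<open>v\<close> for both ends. Such a vertex has a larger \<open>?f\<close> than
        \<open>v\<close>.\<close>
      moreover have "d a x + d v b \<le> max (d a b + d x v) (d a v + d x b)"
        "d a z + d v b \<le> max (d a b + d z v) (d a v + d z b)"
        using four_point[of a x b v] four_point[of a z b v] xz v a b by auto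
      ultimately show False
        using max[of x] max[of z] off pos xz v a b by auto
    qed
  qed
  then have "tree_metric (V - {v}) d"
    unfolding tree_metric_def tree_metric_axioms_def using four_point by auto
  ultimately show ?thesis using v by blast
qed

end

context graph_metric
begin

text \<open>A geodesic through all vertices makes \<open>d a\<close> a bijection onto
  \<open>{..<card V}\<close>, a labelling of the vertices along a path; distances are bounded by
  differences of labels.\<close>

lemma metric_eds_le_path_if_hamiltonian:
  assumes a: "a \<in> V" and b: "b \<in> V" and long: "Suc (d a b) = card V"
  shows "metric_eds V d \<le> path_eds (card V)"
proof -
  let ?n = "card V"
  have "{..d a b} = d a ` V"
    using card_seteq[OF _ level_in_image[OF a b]] finite_V card_image_le[OF finite_V, of "d a"]
      long by simp
  then have img: "d a ` V = {..<?n}" using long by (metis lessThan_Suc_atMost)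
  then have inj: "inj_on (d a) V" by (intro eq_card_imp_inj_on finite_V) simp
  \<comment> \<open>A geodesic from \<open>a\<close> to \<open>w\<close> has a vertex at the level
    of \<open>u\<close>; by injectivity of \<open>d a\<close> it is \<open>u\<close> itself.\<close>
  have le: "d u w \<le> d a w - d a u" if uw: "u \<in> V" "w \<in> V" "d a u \<le> d a w" for u w
  proof -
    obtain x where "x \<in> V" "d a x = d a u" "d x w = d a w - d a u"
      using geodesic_point[OF a uw(2,3)] by blast
    then show ?thesis using inj uw(1) by (metis inj_onD order_refl)
  qed
  have dist: "d u w \<le> (d a u - d a w) + (d a w - d a u)" if "u \<in> V" "w \<in> V" for u w
    using le[of u w] le[of w u] d_sym[of u w] that by (cases "d a u \<le> d a w") auto
  have less: "d a u < ?n" if "u \<in> V" for u using dist_less_card[OF a that] .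
  have "metric_eds V d \<le> (\<Sum>u\<in>V. max (d a u) (?n - 1 - d a u) * path_dsum ?n (d a u))"
    unfolding metric_eds_def
  proof (intro sum_mono mult_le_mono)
    fix u assume u: "u \<in> V"
    show "metric_ecc V d u \<le> max (d a u) (?n - 1 - d a u)"
      unfolding metric_ecc_def
    proof (rule Max.boundedI)
      fix k assume "k \<in> d u ` V"
      then obtain w where "w \<in> V" "k = d u w" by blast
      then show "k \<le> max (d a u) (?n - 1 - d a u)"
        using dist[OF u, of w] less[of w] by auto
    qed (use finite_V u in auto)
    have "(\<Sum>w\<in>V. d w u) \<le> (\<Sum>w\<in>V. (d a u - d a w) + (d a w - d a u))"
      using dist[OF _ u] by (intro sum_mono) (simp add: add.commute)
    also have "\<dots> = path_dsum ?n (d a u)"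
      unfolding path_dsum_def img[symmetric] by (simp add: sum.reindex[OF inj])
    finally show "(\<Sum>w\<in>V. d w u) \<le> path_dsum ?n (d a u)" .
  qed
  also have "\<dots> = path_eds ?n"
    unfolding path_eds_def img[symmetric] by (simp add: sum.reindex[OF inj])
  finally show ?thesis .
qed

end

text \<open>Rearranged, \<open>e^2 * (2 * k + 3 - e)\<close> is at most its value at
  \<open>e = k\<close>. Substituting \<open>k = e + j\<close> leaves only nonnegative terms.\<close>

lemma quadratic_mono:
  fixes e k :: nat
  assumes "e \<le> k"
  shows "e ^ 2 * (2 * k + 3) \<le> k ^ 2 * (k + 3) + e ^ 3"
proof -
  obtain j where "k = e + j" using assms le_Suc_ex by blast
  then show ?thesis by (simp add: power2_eq_square power3_eq_cube algebra_simps)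
qed

theorem metric_eds_le_path:
  assumes "tree_metric V d" and "V \<noteq> {}"
  shows "metric_eds V d \<le> path_eds (card V)"
  using assms
proof (induction "card V" arbitrary: V rule: less_induct)
  case less
  interpret tree_metric V d by fact
  have "Max (case_prod d ` (V \<times> V)) \<in> case_prod d ` (V \<times> V)"
    using finite_V less.prems(2) by (intro Max_in) auto
  then obtain a b where a: "a \<in> V" and b: "b \<in> V"
    and "Max (case_prod d ` (V \<times> V)) = d a b" by auto
  then have diam: "d x y \<le> d a b" if "x \<in> V" "y \<in> V" for x y
    using Max_ge[of "case_prod d ` (V \<times> V)" "d x y"] finite_V that by force
  show ?case
  proof (cases "Suc (d a b) = card V")
    case True
    then show ?thesis using metric_eds_le_path_if_hamiltonian a b by blast
  next
    case False
    then have short: "Suc (d a b) < card V" using dist_less_card[OF a b] by simp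
    then obtain v where v: "v \<in> V" "v \<noteq> a" "v \<noteq> b" and tm: "tree_metric (V - {v}) d"
      using exists_removable[OF a b] by blast
    let ?W = "V - {v}" and ?D = "d a b" and ?S = "\<Sum>x\<in>V. d x v"
    have cW: "card V = Suc (card ?W)" using card.remove[OF finite_V v(1)] .
    \<comment> \<open>Here \<open>k = card V - 2\<close>: since the diameter is not
      \<open>card V - 1\<close>, it is at most \<open>k\<close>.\<close>
    obtain k where k: "card V = Suc (Suc k)" "?D \<le> k"
      using short that[of "card V - 2"] by linarith
    have IH: "metric_eds ?W d \<le> path_eds (Suc k)"
    proof -
      have "card ?W < card V" "?W \<noteq> {}" "card ?W = Suc k" using cW k(1) a v(2) by auto
      then show ?thesis using less.hyps[of ?W] tm by metis
    qed
    have ecc: "metric_ecc V d u = max (d u a) (d u b)" "metric_ecc V d u \<le> ?D" if "u \<in> V" for u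
      using metric_ecc_diametral[OF a b _ that] diam[OF that] diam a b by auto
    \<comment> \<open>Both diametral ends survive in \<open>?W\<close> because \<open>v\<close>
      differs from \<open>a\<close> and \<open>b\<close>.\<close>
    have eccW: "metric_ecc V d u = metric_ecc ?W d u" if "u \<in> ?W" for u
      using metric_ecc_diametral[of a ?W b u] ecc[of u] diam a b v that by auto
    have "metric_eds V d = metric_ecc V d v * ?S
        + (\<Sum>u\<in>?W. metric_ecc V d u * (\<Sum>x\<in>V. d x u))"
      unfolding metric_eds_def by (rule sum.remove[OF finite_V v(1)])
    also have "(\<Sum>u\<in>?W. metric_ecc V d u * (\<Sum>x\<in>V. d x u)) =
        (\<Sum>u\<in>?W. metric_ecc V d u * d u v + metric_ecc ?W d u * (\<Sum>x\<in>?W. d x u))"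
    proof (rule sum.cong)
      fix u assume u: "u \<in> ?W"
      have "(\<Sum>x\<in>V. d x u) = d u v + (\<Sum>x\<in>?W. d x u)"
        using sum.remove[OF finite_V v(1), of "\<lambda>x. d x u"] d_sym u v by simp
      then show "metric_ecc V d u * (\<Sum>x\<in>V. d x u) =
          metric_ecc V d u * d u v + metric_ecc ?W d u * (\<Sum>x\<in>?W. d x u)"
        using eccW[OF u] by (simp add: distrib_left)
    qed simp
    also have "\<dots> = (\<Sum>u\<in>?W. metric_ecc V d u * d u v) + metric_eds ?W d"
      unfolding metric_eds_def sum.distrib ..
    also have "(\<Sum>u\<in>?W. metric_ecc V d u * d u v) \<le> ?D * ?S"
    proof -
      have "(\<Sum>u\<in>?W. metric_ecc V d u * d u v) \<le> (\<Sum>u\<in>?W. ?D * d u v)"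
        using ecc(2) by (intro sum_mono mult_le_mono1) auto
      also have "\<dots> \<le> (\<Sum>u\<in>V. ?D * d u v)"
        using finite_V by (intro sum_mono2) auto
      finally show ?thesis by (simp add: sum_distrib_left)
    qed
    \<comment> \<open>The factor 2 counts the own term of \<open>v\<close> and the distances to
      \<open>v\<close> inside the terms of the other vertices; each is at most
      \<open>?D * ?S\<close>.\<close>
    finally have step: "metric_eds V d \<le> 2 * ?D * ?S + metric_eds ?W d"
      using mult_le_mono1[OF ecc(2)[OF v(1)], of ?S] by linarith
    \<comment> \<open>The farther of \<open>a\<close> and \<open>b\<close> from \<open>v\<close> is
      a farthest vertex from \<open>v\<close>, as \<open>transmission_bound\<close>
      requires.\<close>
    obtain w where w: "w \<in> V" "\<And>x. x \<in> V \<Longrightarrow> d x v \<le> d v w"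
    proof (cases "d v a \<le> d v b")
      case True
      then show ?thesis
        using that[OF b] dist_le_diametral[OF a b diam v(1)] d_sym[OF v(1)] by force
    next
      case False
      then show ?thesis
        using that[OF a] dist_le_diametral[OF a b diam v(1)] d_sym[OF v(1)] by force
    qed
    let ?e = "d v w"
    have "?e \<le> ?D" using diam v(1) w(1) .
    have "2 * ?S + ?e * Suc ?e \<le> 2 * Suc (Suc k) * ?e"
      using transmission_bound[OF v(1) w] k(1) by simp
    then have "int (2 * ?S + ?e * Suc ?e) \<le> int (2 * Suc (Suc k) * ?e)"
      by (simp only: of_nat_le_iff)
    then have "2 * int ?S \<le> int ?e * (2 * int k + 3 - int ?e)"
      by (simp add: algebra_simps)
    \<comment> \<open>The parabola \<open>x * (2 * k + 3 - x)\<close> increases up to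
      \<open>k + 3/2\<close>, so \<open>?e\<close> may be raised to \<open>?D\<close>, which is at
      most \<open>k\<close>; the difference of the two sides factorises.\<close>
    also have "\<dots> \<le> int ?D * (2 * int k + 3 - int ?D)"
    proof -
      have "0 \<le> (int ?D - int ?e) * (2 * int k + 3 - int ?e - int ?D)"
        using \<open>?e \<le> ?D\<close> k(2) by (intro mult_nonneg_nonneg) auto
      then show ?thesis by (simp add: algebra_simps)
    qed
    finally have "int ?D * (2 * int ?S) \<le> int ?D * (int ?D * (2 * int k + 3 - int ?D))"
      by (rule mult_left_mono) simp
    also have "\<dots> \<le> int k ^ 2 * (int k + 3)"
    proof -
      have "int (?D ^ 2 * (2 * k + 3)) \<le> int (k ^ 2 * (k + 3) + ?D ^ 3)"
        using quadratic_mono[OF k(2)] by (simp only: of_nat_le_iff)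
      then show ?thesis by (simp add: power2_eq_square power3_eq_cube algebra_simps)
    qed
    finally have "int (2 * ?D * ?S) \<le> int (k ^ 2 * (k + 3))" by (simp add: algebra_simps)
    then have "2 * ?D * ?S \<le> k ^ 2 * (k + 3)" by (simp only: of_nat_le_iff)
    then show ?thesis using step IH path_eds_growth[of k] k(1) by simp
  qed
qed

section \<open>Distances in undirected trees\<close>

lemma length_rev_path [simp]: "length (rev_path p) = length p"
  by (induction p) auto

context pair_graph
begin

lemma graph_dist_le: "awalk u p v \<Longrightarrow> graph_dist G u v \<le> length p"
  unfolding graph_dist_def by (rule Least_le) blast

text \<open>\<open>connected\<close> refers to the symmetric closure, but the arcs are already
  symmetric, so a walk exists and the \<open>LEAST\<close> in \<open>graph_dist\<close> is
  attained.\<close>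

lemma shortest_awalk:
  assumes "connected (with_proj G)" "u \<in> pverts G" "v \<in> pverts G"
  obtains p where "awalk u p v" "length p = graph_dist G u v"
proof -
  have "u \<rightarrow>\<^sup>*\<^bsub>with_proj (mk_symmetric (with_proj G))\<^esub> v"
    using assms unfolding connected_def strongly_connected_def by simp
  then have "\<exists>p. awalk u p v"
    using reachable_mk_symmetric_eq[OF sym_arcs] reachable_awalk by simp
  then have "\<exists>k p. awalk u p v \<and> length p = k" by blast
  then have "\<exists>p. awalk u p v \<and> length p = graph_dist G u v"
    unfolding graph_dist_def by (rule LeastI_ex)
  then show thesis using that by blast
qed

lemma graph_dist_zero_iff:
  assumes "connected (with_proj G)" "u \<in> pverts G" "v \<in> pverts G"
  shows "graph_dist G u v = 0 \<longleftrightarrow> u = v"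
proof
  assume "graph_dist G u v = 0"
  then show "u = v" using shortest_awalk[OF assms] by (metis awalk_empty_ends length_0_conv)
next
  assume "u = v"
  then show "graph_dist G u v = 0"
    using graph_dist_le[of u "[]" u] assms(2) by (simp add: awalk_Nil_iff)
qed

lemma graph_dist_le_swap:
  assumes "connected (with_proj G)" "u \<in> pverts G" "v \<in> pverts G"
  shows "graph_dist G u v \<le> graph_dist G v u"
  using shortest_awalk[OF assms(1,3,2)] graph_dist_le awalk_rev_path length_rev_path by metis

lemma arc_if_graph_dist_1:
  assumes "connected (with_proj G)" "u \<in> pverts G" "v \<in> pverts G" "graph_dist G u v = 1"
  shows "(u, v) \<in> parcs G"
proof -
  obtain p where "awalk u p v" "length p = 1" using shortest_awalk[OF assms(1-3)] assms(4) by metis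
  then show ?thesis by (cases p) (auto simp: awalk_simps)
qed

text \<open>Reversal gives symmetry and concatenation the triangle inequality; the penultimate
  vertex of a shortest walk supplies the geodesic step.\<close>

lemma graph_metric_graph_dist:
  assumes conn: "connected (with_proj G)"
  shows "graph_metric (pverts G) (graph_dist G)"
proof
  show "finite (pverts G)" by (rule pair_finite_verts)
  show "graph_dist G x y = graph_dist G y x" if "x \<in> pverts G" "y \<in> pverts G" for x y
    using graph_dist_le_swap[OF conn that] graph_dist_le_swap[OF conn that(2,1)] by simp
  show tri: "graph_dist G x z \<le> graph_dist G x y + graph_dist G y z"
    if "x \<in> pverts G" "y \<in> pverts G" "z \<in> pverts G" for x y z
    using shortest_awalk[OF conn that(1,2)] shortest_awalk[OF conn that(2,3)]
      graph_dist_le awalk_appendI length_append by metis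
  fix x z assume xz: "x \<in> pverts G" "z \<in> pverts G" "x \<noteq> z"
  obtain p where p: "awalk x p z" "length p = graph_dist G x z"
    using shortest_awalk[OF conn xz(1,2)] .
  with xz(3) obtain q e where pe: "p = q @ [e]" by (cases p rule: rev_cases) (auto simp: awalk_simps)
  obtain y where q: "awalk x q y" and e: "awalk y [e] z" using p(1) pe by auto
  have e': "(y, z) \<in> parcs G" using e by (auto simp: awalk_simps)
  have y: "y \<in> pverts G" using e' in_arcsD1 by blast
  have "graph_dist G y z = 1"
    using graph_dist_le[OF e] graph_dist_zero_iff[OF conn y xz(2)] no_loops'[OF e'] by simp
  moreover have "graph_dist G x z = Suc (graph_dist G x y)"
    using graph_dist_le[OF q] p(2) pe tri[OF xz(1) y xz(2)] calculation by simp
  ultimately show "\<exists>y\<in>pverts G. graph_dist G y z = 1 \<and> graph_dist G x z = Suc (graph_dist G x y)"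
    using y by blast
qed (simp add: graph_dist_zero_iff[OF conn])

text \<open>Shortest walks to \<open>r\<close> from two distinct such neighbours avoid
  \<open>v\<close>. Joined at \<open>r\<close> and shortened to a path, they close up through
  \<open>v\<close> to a cycle.\<close>

lemma unique_parent_if_acyclic:
  assumes conn: "connected (with_proj G)"
    and acyclic: "\<not> (\<exists>p. cycle p \<and> 3 \<le> length p)"
    and V: "r \<in> pverts G" "v \<in> pverts G" "x \<in> pverts G" "y \<in> pverts G"
    and "graph_dist G x v = 1" "graph_dist G y v = 1"
    and "graph_dist G r x \<le> graph_dist G r v" "graph_dist G r y \<le> graph_dist G r v"
  shows "x = y"
proof (rule ccontr)
  assume "x \<noteq> y"
  interpret graph_metric "pverts G" "graph_dist G" by (rule graph_metric_graph_dist[OF conn])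
  have avoid: "\<exists>p. awalk z p r \<and> v \<notin> set (awalk_verts z p)"
    if z: "z \<in> pverts G" "graph_dist G z v = 1" "graph_dist G r z \<le> graph_dist G r v" for z
  proof -
    obtain p where p: "awalk z p r" "length p = graph_dist G z r"
      using shortest_awalk[OF conn z(1) V(1)] .
    \<comment> \<open>Passing through \<open>v\<close> after at least one arc would make
      \<open>v\<close> strictly closer to \<open>r\<close> than \<open>z\<close>.\<close>
    have "v \<notin> set (awalk_verts z p)"
    proof
      assume "v \<in> set (awalk_verts z p)"
      then obtain p1 p2 where dec: "p = p1 @ p2" "awalk z p1 v" "awalk v p2 r"
        using awalk_decomp[OF p(1)] by blast
      have "p1 \<noteq> []" using dec(2) z(2) d_zero_iff[OF V(2,2)] by (auto simp: awalk_Nil_iff)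
      then show False
        using dec(1) graph_dist_le[OF dec(3)] p(2) z(3) d_sym[OF z(1) V(1)] d_sym[OF V(2,1)]
        by (cases p1) auto
    qed
    then show ?thesis using p(1) by blast
  qed
  obtain p where p: "awalk x p r" "v \<notin> set (awalk_verts x p)" using avoid assms by blast
  obtain q where q: "awalk y q r" "v \<notin> set (awalk_verts y q)" using avoid assms by blast
  have q': "awalk r (rev_path q) y" "v \<notin> set (awalk_verts r (rev_path q))"
    using q awalk_verts_rev_path[OF q(1)] by auto
  let ?w = "p @ rev_path q"
  have w: "awalk x ?w y" using p(1) q'(1) by (rule awalk_appendI)
  have "v \<notin> set (awalk_verts x ?w)"
    using p q' by (auto simp: set_awalk_verts_append)
  \<comment> \<open>The path uses only arcs of the joined walk, so \<open>v\<close> stays off it;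
    being nonempty, it yields at least three arcs once the two arcs at \<open>v\<close> are
    added.\<close>
  moreover obtain P where P: "apath x P y" "set P \<subseteq> set ?w"
    using apath_awalk_to_apath[OF w] awalk_to_apath_subset[OF w] by blast
  moreover have "P \<noteq> []" using P(1) \<open>x \<noteq> y\<close> by (auto simp: apath_Nil_iff)
  ultimately have vP: "v \<notin> set (awalk_verts x P)"
    using set_awalk_verts_not_Nil[of x P y] set_awalk_verts[OF w] by (auto simp: apath_def)
  have arcs: "(v, x) \<in> parcs G" "(y, v) \<in> parcs G"
    using arc_if_graph_dist_1[OF conn V(3,2)] arc_if_graph_dist_1[OF conn V(4,2)] assms
      arcs_symmetric by blast+
  let ?c = "(v, x) # P @ [(y, v)]"
  have "awalk x (P @ [(y, v)]) v"
    using P(1) arcs(2) V by (intro awalk_appendI[of _ _ y]) (auto simp: apath_def awalk_simps)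
  then have "awalk v ?c v" using arcs(1) by (simp add: awalk_Cons_iff del: awalk_append_iff)
  moreover have "distinct (tl (awalk_verts v ?c))"
    using P(1) vP awalk_verts_append[OF \<open>awalk x (P @ [(y, v)]) v\<close>] by (auto simp: apath_def)
  ultimately have "cycle ?c" unfolding cycle_def by blast
  moreover have "3 \<le> length ?c" using \<open>P \<noteq> []\<close> by (cases P) auto
  ultimately show False using acyclic by blast
qed

end

lemma tree_metric_graph_dist:
  assumes "undirected_tree G"
  shows "tree_metric (pverts G) (graph_dist G)"
proof -
  interpret pair_graph G using assms unfolding undirected_tree_def by blast
  have conn: "connected (with_proj G)" and acyclic: "\<not> (\<exists>p. cycle p \<and> 3 \<le> length p)"
    using assms unfolding undirected_tree_def by blast+
  interpret graph_metric "pverts G" "graph_dist G" by (rule graph_metric_graph_dist[OF conn])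
  show ?thesis
  proof
    fix u w a b assume "u \<in> pverts G" "w \<in> pverts G" "a \<in> pverts G" "b \<in> pverts G"
    then show "graph_dist G u w + graph_dist G a b \<le>
        max (graph_dist G u a + graph_dist G w b) (graph_dist G u b + graph_dist G w a)"
      using four_point_of_unique_parent[OF graph_metric_axioms]
        unique_parent_if_acyclic[OF conn acyclic] by blast
  qed
qed

section \<open>The path graph\<close>

text \<open>This counting bound is meant for a dominating set \<open>A\<close>, with
  \<open>N v\<close> containing everything that \<open>v\<close> dominates.\<close>

lemma card_le_mult_card_cover:
  assumes fin: "finite A" and "\<And>v. v \<in> A \<Longrightarrow> finite (N v) \<and> card (N v) \<le> k" and "V \<subseteq> \<Union> (N ` A)"
  shows "card V \<le> k * card A"
proof -
  have "card V \<le> card (\<Union> (N ` A))" using assms by (intro card_mono) auto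
  also have "\<dots> \<le> (\<Sum>v\<in>A. card (N v))" by (rule card_UN_le[OF fin])
  also have "\<dots> \<le> of_nat (card A) * k" using assms by (intro sum_bounded_above) auto
  finally show ?thesis by (simp add: mult.commute)
qed

lemma pair_graph_path_graph: "pair_graph (path_graph n)"
proof
  show "finite (parcs (path_graph n))"
    by (rule finite_subset[of _ "{..<n} \<times> {..<n}"]) (auto simp: path_graph_def)
qed (auto simp: path_graph_def symmetric_def arcs_ends_conv intro: symI)

interpretation path: pair_graph "path_graph n" for n
  by (rule pair_graph_path_graph)

lemma pverts_path_graph [simp]: "pverts (path_graph n) = {..<n}"
  by (simp add: path_graph_def)

lemma parcs_path_graph:
  "(i, j) \<in> parcs (path_graph n) \<longleftrightarrow> i < n \<and> j < n \<and> (j = Suc i \<or> i = Suc j)"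
  by (simp add: path_graph_def)

lemma connected_path_graph:
  assumes "0 < n"
  shows "connected (with_proj (path_graph n))"
proof -
  have up: "i \<rightarrow>\<^sup>*\<^bsub>with_proj (path_graph n)\<^esub> (i + k)" if "i + k < n" for i k
    using that
  proof (induction k)
    case 0
    then show ?case by (simp add: path.reachable_refl)
  next
    case (Suc k)
    then have "(i + k, Suc (i + k)) \<in> parcs (path_graph n)" by (simp add: parcs_path_graph)
    then have "(i + k) \<rightarrow>\<^bsub>with_proj (path_graph n)\<^esub> Suc (i + k)" by simp
    then show ?case using Suc path.reachable_adj_trans by simp
  qed
  have "i \<rightarrow>\<^sup>*\<^bsub>with_proj (path_graph n)\<^esub> j" if "i < n" "j < n" for i j
    using up[of i "j - i"] up[of j "i - j"] that
    by (cases "i \<le> j") (auto intro: path.symmetric_reachable')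
  then show ?thesis
    using assms unfolding connected_def strongly_connected_def
    by (auto simp: path.reachable_mk_symmetric_eq[OF path.sym_arcs])
qed

lemma path_graph_awalk_length:
  assumes "pre_digraph.awalk (with_proj (path_graph n)) i p j"
  shows "(i - j) + (j - i) \<le> length p"
  using assms
proof (induction p arbitrary: i)
  case (Cons e p)
  then have "fst e = i" "path.awalk n (snd e) p j" "e \<in> parcs (path_graph n)"
    by (auto simp: path.awalk_Cons_iff)
  then show ?case using Cons.IH[of "snd e"] parcs_path_graph[of "fst e" "snd e" n] by auto
qed (simp add: path.awalk_Nil_iff)

lemma path_graph_dist_ge:
  assumes "i < n" "j < n"
  shows "(i - j) + (j - i) \<le> graph_dist (path_graph n) i j"
proof -
  have "connected (with_proj (path_graph n))" using connected_path_graph assms by simp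
  then obtain p where "path.awalk n i p j" "length p = graph_dist (path_graph n) i j"
    using path.shortest_awalk[of n i j] assms by auto
  then show ?thesis using path_graph_awalk_length by metis
qed

text \<open>Walks in the path change the index by one per arc, which bounds distances below; the
  vertices \<open>0\<close> and \<open>n - 1\<close> then bound the eccentricity.\<close>

lemma path_eds_le_eccentric_dist_sum: "path_eds n \<le> eccentric_dist_sum (path_graph n)"
  unfolding path_eds_def eccentric_dist_sum_def pverts_path_graph
proof (intro sum_mono mult_le_mono)
  fix i assume "i \<in> {..<n}"
  then have i: "i < n" by simp
  have ge: "graph_dist (path_graph n) i j \<le> eccentricity (path_graph n) i" if "j < n" for j
    unfolding eccentricity_def using that by (intro Max_ge) auto
  show "max i (n - 1 - i) \<le> eccentricity (path_graph n) i"
    using ge[of 0] ge[of "n - 1"] path_graph_dist_ge[of i n 0] path_graph_dist_ge[of i n "n - 1"] i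
    by simp
  show "path_dsum n i \<le> dist_sum (path_graph n) i"
    unfolding path_dsum_def dist_sum_def pverts_path_graph
    using path_graph_dist_ge i by (intro sum_mono) (simp add: add.commute)
qed

text \<open>A walk without repeated vertices cannot turn back, so it sweeps the interval between its
  ends monotonically.\<close>

lemma path_graph_apath_verts:
  assumes "pre_digraph.awalk (with_proj (path_graph n)) i p j" "distinct (pawalk_verts i p)"
  shows "set (pawalk_verts i p) = {min i j..max i j} \<and> length p = (i - j) + (j - i)"
  using assms
proof (induction p arbitrary: i)
  case (Cons e p)
  let ?w = "snd e"
  have e: "fst e = i" "path.awalk n ?w p j" "e \<in> parcs (path_graph n)"
    using Cons.prems(1) by (auto simp: path.awalk_Cons_iff)
  have IH: "set (pawalk_verts ?w p) = {min ?w j..max ?w j}" "length p = (?w - j) + (j - ?w)"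
    using Cons.IH[OF e(2)] Cons.prems(2) by auto
  have "i \<notin> {min ?w j..max ?w j}" using Cons.prems(2) e(1) IH(1) by auto
  then have "?w = Suc i \<and> ?w \<le> j \<or> i = Suc ?w \<and> j \<le> ?w"
    using parcs_path_graph[of i ?w n] e(1,3) by (cases e) auto
  then show ?case using IH e(1) by auto
qed (simp add: path.awalk_Nil_iff)

text \<open>After the first arc of a cycle, the rest is a walk with distinct vertices back from a
  neighbour, hence a single arc: all cycles have length 2.\<close>

lemma undirected_tree_path_graph:
  assumes "0 < n"
  shows "undirected_tree (path_graph n)"
proof -
  have "\<not> 3 \<le> length c" if c: "pre_digraph.cycle (with_proj (path_graph n)) c" for c
  proof -
    obtain i where i: "path.awalk n i c i" "distinct (tl (pawalk_verts i c))" "c \<noteq> []"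
      using c unfolding path.cycle_def by blast
    then obtain e p where c: "c = e # p" by (cases c) auto
    have "fst e = i" "path.awalk n (snd e) p i" "e \<in> parcs (path_graph n)"
      using i(1) c by (auto simp: path.awalk_Cons_iff)
    moreover have "length p = (snd e - i) + (i - snd e)"
      using path_graph_apath_verts[of n "snd e" p i] calculation i(2) c by simp
    ultimately show ?thesis using parcs_path_graph[of "fst e" "snd e" n] c by auto
  qed
  then show ?thesis
    unfolding undirected_tree_def using pair_graph_path_graph connected_path_graph assms by blast
qed

section \<open>The domination number of the path\<close>

lemma path_graph_dominating_set_card:
  assumes "dominating_set (path_graph n) S"
  shows "n \<le> 3 * card S"
proof -
  have S: "S \<subseteq> {..<n}" and dom: "\<forall>v\<in>{..<n} - S. \<exists>u\<in>S. (v, u) \<in> parcs (path_graph n)"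
    using assms unfolding dominating_set_def by auto
  have "finite S" using S finite_subset by blast
  have "card {..<n} \<le> 3 * card S"
  \<comment> \<open>Each \<open>u\<close> dominates at most itself and its two neighbours. At the
    ends these sets contain a coincidence or a non-vertex, which is harmless for an upper bound on
    their size.\<close>
  proof (rule card_le_mult_card_cover[where N = "\<lambda>u. {u - 1, u, u + 1}"])
    show "{..<n} \<subseteq> (\<Union>u\<in>S. {u - 1, u, u + 1})"
    proof
      fix v assume v: "v \<in> {..<n}"
      show "v \<in> (\<Union>u\<in>S. {u - 1, u, u + 1})"
      proof (cases "v \<in> S")
        case False
        then obtain u where "u \<in> S" "(v, u) \<in> parcs (path_graph n)" using dom v by blast
        then show ?thesis by (intro UN_I[of u]) (auto simp: parcs_path_graph)
      qed auto
    qed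
  qed (use \<open>finite S\<close> in \<open>auto simp: card_insert_if\<close>)
  then show ?thesis by simp
qed

lemma path_graph_dominating_set_exists:
  assumes "0 < n"
  shows "\<exists>S. dominating_set (path_graph n) S \<and> card S \<le> (n + 2) div 3"
proof (intro exI conjI)
  \<comment> \<open>The vertices are cut into blocks of three and each block is represented by its
    middle; the \<open>min\<close> handles a last block consisting of one vertex.\<close>
  let ?f = "\<lambda>k. min (3 * k + 1) (n - 1)"
  let ?S = "?f ` {..<(n + 2) div 3}"
  show "card ?S \<le> (n + 2) div 3" using card_image_le[of "{..<(n + 2) div 3}" ?f] by simp
  show "dominating_set (path_graph n) ?S"
    unfolding dominating_set_def pverts_path_graph
  proof (intro conjI ballI)
    fix v assume v: "v \<in> {..<n} - ?S"
    define u where "u = ?f (v div 3)"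
    have u: "u \<in> ?S" unfolding u_def using v by (intro imageI) auto
    then have "v \<noteq> u" using v by blast
    have "v < n" using v by simp
    have "v mod 3 < 3" "v = 3 * (v div 3) + v mod 3" by simp_all
    then have "v \<le> u + 1" "u \<le> v + 1" "u < n" using \<open>v < n\<close> unfolding u_def by linarith+
    then have "(v, u) \<in> parcs (path_graph n)"
      unfolding parcs_path_graph using \<open>v < n\<close> \<open>v \<noteq> u\<close> by linarith
    with u show "\<exists>u\<in>?S. (v, u) \<in> parcs (path_graph n)" by blast
  qed (use assms in auto)
qed

lemma domination_number_path_graph:
  assumes "0 < n"
  shows "domination_number (path_graph n) = (n + 2) div 3"
  unfolding domination_number_def
proof (rule Min_eqI)
  have "{S. dominating_set (path_graph n) S} \<subseteq> Pow {..<n}" by (auto simp: dominating_set_def)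
  then show "finite (card ` {S. dominating_set (path_graph n) S})"
    by (intro finite_imageI) (rule finite_subset, auto)
  have ge: "(n + 2) div 3 \<le> card S" if "dominating_set (path_graph n) S" for S
    using path_graph_dominating_set_card[OF that] by linarith
  then show "(n + 2) div 3 \<le> k" if "k \<in> card ` {S. dominating_set (path_graph n) S}" for k
    using that by blast
  obtain S where S: "dominating_set (path_graph n) S" "card S \<le> (n + 2) div 3"
    using path_graph_dominating_set_exists[OF assms] by blast
  then have "card S = (n + 2) div 3" using ge le_antisym by blast
  then show "(n + 2) div 3 \<in> card ` {S. dominating_set (path_graph n) S}" using S(1) by force
qed

lemma nat_ceiling_third: "nat \<lceil>real n / 3\<rceil> = (n + 2) div 3"
proof -
  have "\<lceil>real n / 3\<rceil> = int ((n + 2) div 3)"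
  proof (rule ceiling_unique)
    have "3 * ((n + 2) div 3) \<le> n + 2" "n \<le> 3 * ((n + 2) div 3)" by linarith+
    then have "3 * real ((n + 2) div 3) \<le> real n + 2" "real n \<le> 3 * real ((n + 2) div 3)"
      by linarith+
    then show "of_int (int ((n + 2) div 3)) - 1 < real n / 3"
      "real n / 3 \<le> of_int (int ((n + 2) div 3))" by simp_all
  qed
  then show ?thesis by simp
qed

theorem theorem2p12:
  fixes n :: nat
  assumes "n > 4"
  shows "path_graph n \<in> trees_with_domination_number n (nat \<lceil>real n / 3\<rceil>) \<and>
    (\<forall>T :: 'a pair_pre_digraph. T \<in> trees_with_domination_number n (nat \<lceil>real n / 3\<rceil>) \<longrightarrow>
       eccentric_dist_sum T \<le> eccentric_dist_sum (path_graph n))"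
proof (intro conjI allI impI)
  show "path_graph n \<in> trees_with_domination_number n (nat \<lceil>real n / 3\<rceil>)"
    unfolding trees_with_domination_number_def nat_ceiling_third
    using undirected_tree_path_graph domination_number_path_graph assms by simp
next
  fix T :: "'a pair_pre_digraph"
  assume "T \<in> trees_with_domination_number n (nat \<lceil>real n / 3\<rceil>)"
  then have T: "undirected_tree T" and card: "card (pverts T) = n"
    unfolding trees_with_domination_number_def by auto
  then have "pverts T \<noteq> {}" using assms by auto
  then have "metric_eds (pverts T) (graph_dist T) \<le> path_eds (card (pverts T))"
    by (intro metric_eds_le_path tree_metric_graph_dist T)
  then have "eccentric_dist_sum T \<le> path_eds n"
    unfolding eccentric_dist_sum_def eccentricity_def dist_sum_def metric_eds_def metric_ecc_def card .
  also have "\<dots> \<le> eccentric_dist_sum (path_graph n)" by (rule path_eds_le_eccentric_dist_sum)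
  finally show "eccentric_dist_sum T \<le> eccentric_dist_sum (path_graph n)" .
qed

end
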